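(* Let $d\ge 1$ and let either $0<q<2$ and $pq\ge 1$ (with $p>0$), or $q=2$ and $\frac12-\frac1d\le p\le 1$ (with this last condition on $p$ replaced by $0<p\le 1$ if $d\le 2$). Let $f\in H^1(\Omega)$. Then $$\int_\Omega |f|^q\,dx-\left(\int_\Omega |f|^{1/p}\,dx\right)^{pq}\le C_B(p,q)\,\|\nabla f\|_{L^2(\Omega)}^q,$$ where $$C_B(p,q)=\frac{2(pq-1)C_P^q}{2-q}\ \text{ if } q<2,\qquad C_B(p,2)=C_P^2\ \text{ if } q=2,$$ and $C_P>0$ is the constant of the Poincaré-Wirtinger inequality on $\Omega$.
   Context: $\Omega\subset\mathbb{R}^d$ is a bounded domain with Lebesgue measure $\mathrm{m}(\Omega)=1$ such that the Poincaré-Wirtinger inequality holds: there is a constant $C_P>0$, depending only on $d$ and $\Omega$, such that $\|f-\bar f\|_{L^2(\Omega)}\le C_P\|\nabla f\|_{L^2(\Omega)}$ for all $f\in H^1(\Omega)$, where $\bar f=\int_\Omega f\,dx$. *)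

theory Defs
  imports "HOL-Analysis.Analysis"
begin

text \<open>Continuous differentiability of order \<open>k\<close> on the whole space, through iterated
  partial derivatives.\<close>

primrec C_k :: "nat \<Rightarrow> ('a::euclidean_space \<Rightarrow> real) \<Rightarrow> bool" where
  "C_k 0 \<phi> \<longleftrightarrow> continuous_on UNIV \<phi>"
| "C_k (Suc k) \<phi> \<longleftrightarrow> \<phi> differentiable_on UNIV \<and>
     (\<forall>b\<in>Basis. C_k k (\<lambda>x. frechet_derivative \<phi> (at x) b))"

definition test_function :: "'a::euclidean_space set \<Rightarrow> ('a \<Rightarrow> real) \<Rightarrow> bool" where
  "test_function \<Omega> \<phi> \<longleftrightarrow> (\<forall>k. C_k k \<phi>) \<and>
     compact (closure {x. \<phi> x \<noteq> 0}) \<and> closure {x. \<phi> x \<noteq> 0} \<subseteq> \<Omega>"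

definition locally_integrable ::
  "'a::euclidean_space set \<Rightarrow> ('a \<Rightarrow> 'b::euclidean_space) \<Rightarrow> bool" where
  "locally_integrable \<Omega> f \<longleftrightarrow>
     (\<forall>K. compact K \<and> K \<subseteq> \<Omega> \<longrightarrow> integrable (lebesgue_on K) f)"

definition has_weak_gradient ::
  "'a::euclidean_space set \<Rightarrow> ('a \<Rightarrow> real) \<Rightarrow> ('a \<Rightarrow> 'a) \<Rightarrow> bool" where
  "has_weak_gradient \<Omega> f g \<longleftrightarrow>
     locally_integrable \<Omega> f \<and> locally_integrable \<Omega> g \<and>
     (\<forall>\<phi>. test_function \<Omega> \<phi> \<longrightarrow>
        (\<forall>b\<in>Basis.
           (\<integral>x. f x * frechet_derivative \<phi> (at x) b \<partial>lebesgue_on \<Omega>) =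
           - (\<integral>x. (g x \<bullet> b) * \<phi> x \<partial>lebesgue_on \<Omega>)))"

text \<open>A weak gradient is unique only up to null sets (for open \<open>\<Omega>\<close>); the choice below is
  harmless because only its \<open>L\<^sup>2\<close> norm is ever used.\<close>

definition weak_gradient :: "'a::euclidean_space set \<Rightarrow> ('a \<Rightarrow> real) \<Rightarrow> ('a \<Rightarrow> 'a)" where
  "weak_gradient \<Omega> f = (SOME g. has_weak_gradient \<Omega> f g)"

text \<open>Elements of \<open>L\<^sup>2(\<Omega>)\<close> and \<open>H\<^sup>1(\<Omega>)\<close> are represented by functions rather than by
  almost-everywhere equivalence classes; values outside \<open>\<Omega>\<close> are irrelevant.\<close>

definition L2 :: "'a::euclidean_space set \<Rightarrow> ('a \<Rightarrow> 'b::euclidean_space) set" where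
  "L2 \<Omega> = {f. f \<in> borel_measurable (lebesgue_on \<Omega>) \<and>
                integrable (lebesgue_on \<Omega>) (\<lambda>x. (norm (f x))\<^sup>2)}"

definition L2_norm :: "'a::euclidean_space set \<Rightarrow> ('a \<Rightarrow> 'b::euclidean_space) \<Rightarrow> real" where
  "L2_norm \<Omega> f = sqrt (\<integral>x. (norm (f x))\<^sup>2 \<partial>lebesgue_on \<Omega>)"

definition H1 :: "'a::euclidean_space set \<Rightarrow> ('a \<Rightarrow> real) set" where
  "H1 \<Omega> = {f \<in> L2 \<Omega>. \<exists>g \<in> L2 \<Omega>. has_weak_gradient \<Omega> f g}"

text \<open>The mean is the plain integral: it is used only for domains of measure one.\<close>

definition poincare_wirtinger :: "'a::euclidean_space set \<Rightarrow> real \<Rightarrow> bool" where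
  "poincare_wirtinger \<Omega> C \<longleftrightarrow>
     (\<forall>f \<in> H1 \<Omega>. L2_norm \<Omega> (\<lambda>x. f x - (\<integral>y. f y \<partial>lebesgue_on \<Omega>))
                  \<le> C * L2_norm \<Omega> (weak_gradient \<Omega> f))"

definition C_B :: "real \<Rightarrow> real \<Rightarrow> real \<Rightarrow> real" where
  "C_B C\<^sub>P p q = (if q < 2 then 2 * (p * q - 1) * C\<^sub>P powr q / (2 - q) else C\<^sub>P\<^sup>2)"

text \<open>Real powers (with positive exponent) on \<open>[0, \<infinity>]\<close>.\<close>

definition ennpowr :: "ennreal \<Rightarrow> real \<Rightarrow> ennreal" where
  "ennpowr x a = (if x = \<infinity> then \<infinity> else ennreal (enn2real x powr a))"

text \<open>The integral of \<open>|f|\<^sup>r\<close>, with value \<open>\<infinity>\<close> if \<open>|f|\<^sup>r\<close> is not integrable.\<close>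

definition power_integral :: "'a::euclidean_space set \<Rightarrow> real \<Rightarrow> ('a \<Rightarrow> real) \<Rightarrow> ennreal" where
  "power_integral \<Omega> r f = (\<integral>\<^sup>+x. ennreal (\<bar>f x\<bar> powr r) \<partial>lebesgue_on \<Omega>)"

end

theory Submission
  imports Defs "HOL-Probability.Probability_Measure"
begin

text \<open>Write \<open>N\<^sub>s = \<integral>|f|\<^sup>s\<close> and \<open>r = 1/p\<close>. For \<open>q < 2\<close>, Lyapunov's interpolation of \<open>N\<^sub>q\<close> between
  \<open>N\<^sub>r\<close> and \<open>N\<^sub>2\<close>, followed by the weighted AM-GM inequality, yields
  \<open>N\<^sub>q - N\<^sub>r\<^bsup>q/r\<^esup> \<le> 2(pq-1)/(2-q) \<cdot> (N\<^sub>2\<^bsup>q/2\<^esup> - N\<^sub>q)\<close>. Let \<open>m\<close> be the mean of \<open>f\<close> and \<open>D = N\<^sub>2 - m\<^sup>2\<close> its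
  variance. Cauchy-Schwarz applied to \<open>|f| = |f|\<^bsup>1-q/2\<^esup> |f|\<^bsup>q/2\<^esup>\<close> and Jensen's inequality give
  \<open>m\<^sup>2 \<le> N\<^bsub>2-q\<^esub> N\<^sub>q \<le> N\<^sub>2\<^bsup>1-q/2\<^esup> N\<^sub>q\<close>, hence
  \<open>N\<^sub>2\<^bsup>q/2\<^esup> - N\<^sub>q \<le> N\<^sub>2\<^bsup>q/2-1\<^esup> D \<le> D\<^bsup>q/2\<^esup>\<close>, and the Poincare-Wirtinger inequality bounds \<open>D\<close>.
  For \<open>q = 2\<close>, Jensen's inequality bounds the left-hand side by \<open>D\<close> directly.\<close>

lemma Youngs_inequality_nonneg:
  fixes a b :: real
  assumes "0 \<le> \<alpha>" "0 \<le> \<beta>" "\<alpha> + \<beta> = 1" "0 \<le> a" "0 \<le> b"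
  shows "a powr \<alpha> * b powr \<beta> \<le> \<alpha> * a + \<beta> * b"
proof (cases "a = 0 \<or> b = 0")
  case True
  \<comment> \<open>Since \<open>0 powr x = 0\<close> for every \<open>x\<close>, including
    \<open>x = 0\<close>, the left-hand side vanishes here.\<close>
  then show ?thesis using assms by auto
next
  case False
  then show ?thesis using assms by (intro Youngs_inequality_0) auto
qed

text \<open>Hoelder with exponents \<open>1 / \<alpha>\<close> and \<open>1 / \<beta>\<close>, put
  on the integrands so that endpoint weights are allowed. Pointwise Young gives an integrable
  majorant; applied to \<open>u / U\<close> and \<open>v / V\<close>, functions of integral one, it
  gives the sharp bound.\<close>

lemma Holder_inequality_powr:
  fixes u v :: "'a \<Rightarrow> real"
  assumes u: "integrable M u" "\<And>x. 0 \<le> u x" and v: "integrable M v" "\<And>x. 0 \<le> v x"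
    and ab: "0 \<le> \<alpha>" "0 \<le> \<beta>" "\<alpha> + \<beta> = 1"
  shows "integrable M (\<lambda>x. u x powr \<alpha> * v x powr \<beta>)"
    and "(\<integral>x. u x powr \<alpha> * v x powr \<beta> \<partial>M) \<le> (\<integral>x. u x \<partial>M) powr \<alpha> * (\<integral>x. v x \<partial>M) powr \<beta>"
proof -
  have [measurable]: "u \<in> borel_measurable M" "v \<in> borel_measurable M"
    using u v by auto
  show int: "integrable M (\<lambda>x. u x powr \<alpha> * v x powr \<beta>)"
  proof (rule Bochner_Integration.integrable_bound)
    show "integrable M (\<lambda>x. \<alpha> * u x + \<beta> * v x)"
      using u v by auto
    show "AE x in M. norm (u x powr \<alpha> * v x powr \<beta>) \<le> norm (\<alpha> * u x + \<beta> * v x)"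
      using u(2) v(2) ab Youngs_inequality_nonneg[of \<alpha> \<beta>]
      by (intro AE_I2) (auto simp: abs_of_nonneg)
  qed measurable
  define U V where "U = (\<integral>x. u x \<partial>M)" and "V = (\<integral>x. v x \<partial>M)"
  have UV: "0 \<le> U" "0 \<le> V"
    unfolding U_def V_def using u v by auto
  have "(\<integral>x. u x powr \<alpha> * v x powr \<beta> \<partial>M) \<le> U powr \<alpha> * V powr \<beta>"
  \<comment> \<open>Normalising would divide by zero in this case, but then one factor vanishes
    almost everywhere.\<close>
  proof (cases "U = 0 \<or> V = 0")
    case True
    then have "(AE x in M. u x = 0) \<or> (AE x in M. v x = 0)"
      unfolding U_def V_def using u v by (simp add: integral_nonneg_eq_0_iff_AE)
    then have "AE x in M. u x powr \<alpha> * v x powr \<beta> = 0"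
      by auto
    then have "(\<integral>x. u x powr \<alpha> * v x powr \<beta> \<partial>M) = (\<integral>x. 0 \<partial>M)"
      by (intro integral_cong_AE) auto
    then show ?thesis by simp
  next
    case False
    then have pos: "U > 0" "V > 0" using UV by auto
    have "(\<integral>x. u x powr \<alpha> * v x powr \<beta> \<partial>M)
        \<le> (\<integral>x. U powr \<alpha> * V powr \<beta> * (\<alpha> * (u x / U) + \<beta> * (v x / V)) \<partial>M)"
    proof (rule integral_mono[OF int])
      show "integrable M (\<lambda>x. U powr \<alpha> * V powr \<beta> * (\<alpha> * (u x / U) + \<beta> * (v x / V)))"
        using u v by auto
      fix x
      have "(u x / U) powr \<alpha> * (v x / V) powr \<beta> \<le> \<alpha> * (u x / U) + \<beta> * (v x / V)"
        using u(2) v(2) ab pos by (intro Youngs_inequality_nonneg) auto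
      then have "U powr \<alpha> * V powr \<beta> * ((u x / U) powr \<alpha> * (v x / V) powr \<beta>)
          \<le> U powr \<alpha> * V powr \<beta> * (\<alpha> * (u x / U) + \<beta> * (v x / V))"
        by (intro mult_left_mono) auto
      also have "U powr \<alpha> * V powr \<beta> * ((u x / U) powr \<alpha> * (v x / V) powr \<beta>) = u x powr \<alpha> * v x powr \<beta>"
        using pos u(2) v(2) by (simp add: powr_divide)
      finally show "u x powr \<alpha> * v x powr \<beta>
          \<le> U powr \<alpha> * V powr \<beta> * (\<alpha> * (u x / U) + \<beta> * (v x / V))" .
    qed
    also have "\<dots> = U powr \<alpha> * V powr \<beta> * (\<alpha> * (U / U) + \<beta> * (V / V))"
      using u v by (simp add: U_def V_def)
    also have "\<dots> = U powr \<alpha> * V powr \<beta>"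
      using pos ab by simp
    finally show ?thesis .
  qed
  then show "(\<integral>x. u x powr \<alpha> * v x powr \<beta> \<partial>M) \<le> (\<integral>x. u x \<partial>M) powr \<alpha> * (\<integral>x. v x \<partial>M) powr \<beta>"
    unfolding U_def V_def .
qed

text \<open>This is Hoelder against the constant function 1, whose integral is one on a probability
  space.\<close>

lemma (in prob_space) Jensen_abs_powr:
  fixes f :: "'a \<Rightarrow> real"
  assumes int: "integrable M (\<lambda>x. \<bar>f x\<bar> powr t)" and st: "0 < s" "s \<le> t"
  shows "integrable M (\<lambda>x. \<bar>f x\<bar> powr s)"
    and "(\<integral>x. \<bar>f x\<bar> powr s \<partial>M) \<le> (\<integral>x. \<bar>f x\<bar> powr t \<partial>M) powr (s / t)"
proof -
  have "(\<lambda>x. (\<bar>f x\<bar> powr t) powr (s / t) * 1 powr (1 - s / t)) = (\<lambda>x. \<bar>f x\<bar> powr s)"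
    using st by (auto simp: powr_powr)
  with Holder_inequality_powr[OF int _ _ _, of "\<lambda>_. 1" "s / t" "1 - s / t"] st
  show "integrable M (\<lambda>x. \<bar>f x\<bar> powr s)"
    and "(\<integral>x. \<bar>f x\<bar> powr s \<partial>M) \<le> (\<integral>x. \<bar>f x\<bar> powr t \<partial>M) powr (s / t)"
    by (simp_all add: prob_space)
qed

lemma integral_abs_powr_interpolation:
  fixes f :: "'a \<Rightarrow> real"
  assumes r: "integrable M (\<lambda>x. \<bar>f x\<bar> powr r)" and t: "integrable M (\<lambda>x. \<bar>f x\<bar> powr t)"
    and rqt: "0 < r" "r \<le> q" "q < t"
  shows "(\<integral>x. \<bar>f x\<bar> powr q \<partial>M) - (\<integral>x. \<bar>f x\<bar> powr r \<partial>M) powr (q / r)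
    \<le> t * (q - r) / (r * (t - q)) *
       ((\<integral>x. \<bar>f x\<bar> powr t \<partial>M) powr (q / t) - (\<integral>x. \<bar>f x\<bar> powr q \<partial>M))"
proof -
  \<comment> \<open>\<open>\<alpha>\<close> is the weight that makes \<open>q\<close> the convex
    combination of \<open>r\<close> and \<open>t\<close>. The weight \<open>\<theta>\<close>
    re-expresses the Lyapunov bound through \<open>N r powr (q / r)\<close> and
    \<open>N t powr (q / t)\<close>, which scale in \<open>f\<close> with the same degree
    \<open>q\<close> as \<open>N q\<close>.\<close>
  define \<alpha> where "\<alpha> = (t - q) / (t - r)"
  define \<theta> where "\<theta> = \<alpha> * r / q"
  define N where "N s = (\<integral>x. \<bar>f x\<bar> powr s \<partial>M)" for s
  have "(t - r) * \<alpha> = t - q" "0 < \<alpha>" "\<alpha> \<le> 1"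
    using rqt by (auto simp: \<alpha>_def)
  then have \<alpha>: "0 < \<alpha>" "\<alpha> \<le> 1" "r * \<alpha> + t * (1 - \<alpha>) = q"
    by (auto simp: algebra_simps)
  have \<theta>: "0 < \<theta>" "\<theta> \<le> 1" "q / r * \<theta> = \<alpha>" "q / t * (1 - \<theta>) = 1 - \<alpha>"
  proof -
    show "0 < \<theta>" "q / r * \<theta> = \<alpha>" using \<alpha> rqt by (auto simp: \<theta>_def)
    have "q - \<alpha> * r = t * (1 - \<alpha>)" using \<alpha>(3) by (simp add: mult.commute)
    moreover have "q * (1 - \<theta>) = q - \<alpha> * r" using rqt by (simp add: \<theta>_def right_diff_distrib)
    ultimately have *: "q * (1 - \<theta>) = t * (1 - \<alpha>)" by simp
    then show "q / t * (1 - \<theta>) = 1 - \<alpha>" using rqt by simp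
    have "0 \<le> q * (1 - \<theta>)" using * \<alpha> rqt by simp
    then show "\<theta> \<le> 1" using rqt by (simp add: zero_le_mult_iff)
  qed
  have eq: "(\<bar>f x\<bar> powr r) powr \<alpha> * (\<bar>f x\<bar> powr t) powr (1 - \<alpha>) = \<bar>f x\<bar> powr q" for x
    using \<alpha>(3) by (simp add: powr_powr flip: powr_add)
  have "N q \<le> N r powr \<alpha> * N t powr (1 - \<alpha>)"
    using Holder_inequality_powr(2)[OF r _ t _, of \<alpha> "1 - \<alpha>"] \<alpha> unfolding N_def eq by simp
  also have "\<dots> = (N r powr (q / r)) powr \<theta> * (N t powr (q / t)) powr (1 - \<theta>)"
    unfolding powr_powr \<theta> ..
  also have "\<dots> \<le> \<theta> * N r powr (q / r) + (1 - \<theta>) * N t powr (q / t)"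
    using \<theta> by (intro Youngs_inequality_nonneg) auto
  \<comment> \<open>Split \<open>N q\<close> as \<open>\<theta> * N q + (1 - \<theta>) * N q\<close>
    and move one share to each side.\<close>
  finally have "\<theta> * (N q - N r powr (q / r)) \<le> (1 - \<theta>) * (N t powr (q / t) - N q)"
    by (simp add: algebra_simps)
  then have "N q - N r powr (q / r) \<le> (1 - \<theta>) / \<theta> * (N t powr (q / t) - N q)"
    using \<theta>(1) by (simp add: field_simps)
  also have "(1 - \<theta>) / \<theta> = t * (q - r) / (r * (t - q))"
  proof -
    have "\<theta> = r * (t - q) / (q * (t - r))" by (simp add: \<theta>_def \<alpha>_def mult.commute)
    moreover have "1 - r * (t - q) / (q * (t - r)) = t * (q - r) / (q * (t - r))"
      using rqt by (simp add: divide_simps) (simp add: algebra_simps)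
    ultimately show ?thesis using rqt by simp
  qed
  finally show ?thesis unfolding N_def .
qed

lemma (in prob_space) integral_abs_powr_deficit_le_variance:
  fixes f :: "'a \<Rightarrow> real"
  assumes f [measurable]: "f \<in> borel_measurable M" and f2: "integrable M (\<lambda>x. (f x)\<^sup>2)"
    and q: "0 < q" "q < 2"
  shows "(\<integral>x. (f x)\<^sup>2 \<partial>M) powr (q / 2) - (\<integral>x. \<bar>f x\<bar> powr q \<partial>M) \<le> variance f powr (q / 2)"
proof -
  define A m N D where "A = (\<integral>x. (f x)\<^sup>2 \<partial>M)" and "m = expectation f"
    and "N = (\<integral>x. \<bar>f x\<bar> powr q \<partial>M)" and "D = variance f"
  have f2': "integrable M (\<lambda>x. \<bar>f x\<bar> powr 2)" using f2 by simp
  note int = Jensen_abs_powr(1)[OF f2']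
  have "integrable M f"
    using f f2 by (rule square_integrable_imp_integrable)
  then have D: "D = A - m\<^sup>2"
    using f2 by (simp add: D_def A_def m_def variance_eq)
  have "A \<ge> 0" "N \<ge> 0" "D \<ge> 0" by (auto simp: A_def N_def D_def)
  \<comment> \<open>Both \<open>q\<close> and \<open>2 - q\<close> lie strictly between 0 and 2, so
    both powers of \<open>f\<close> are integrable, and Jensen can later compare the first with
    \<open>A\<close>.\<close>
  have eq: "(\<bar>f x\<bar> powr (2 - q)) powr (1/2) * (\<bar>f x\<bar> powr q) powr (1/2) = \<bar>f x\<bar>" for x
  proof -
    have "(2 - q) * (1/2) + q * (1/2) = 1" by (simp add: field_simps)
    then show ?thesis by (simp only: powr_powr powr_add[symmetric]) simp
  qed
  have "\<bar>m\<bar> \<le> (\<integral>x. \<bar>f x\<bar> \<partial>M)"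
    unfolding m_def by (rule integral_abs_bound)
  also have "\<dots> \<le> (\<integral>x. \<bar>f x\<bar> powr (2 - q) \<partial>M) powr (1/2) * N powr (1/2)"
    using Holder_inequality_powr(2)[OF int[of "2 - q"] _ int[of q] _, of "1/2" "1/2"] q
    unfolding N_def eq by simp
  finally have "\<bar>m\<bar>\<^sup>2 \<le> ((\<integral>x. \<bar>f x\<bar> powr (2 - q) \<partial>M) powr (1/2) * N powr (1/2))\<^sup>2"
    by (rule power_mono) simp
  also have "\<dots> = (\<integral>x. \<bar>f x\<bar> powr (2 - q) \<partial>M) * N"
    using \<open>N \<ge> 0\<close> by (simp add: power_mult_distrib powr_half_sqrt)
  also have "\<dots> \<le> A powr ((2 - q) / 2) * N"
    using Jensen_abs_powr(2)[OF f2', of "2 - q"] q \<open>N \<ge> 0\<close>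
    by (intro mult_right_mono) (auto simp: A_def)
  finally have m: "m\<^sup>2 \<le> A powr (1 - q / 2) * N" by (simp add: diff_divide_distrib)
  have "A powr (q / 2) - N \<le> D powr (q / 2)"
  \<comment> \<open>The negative power \<open>D powr (q / 2 - 1)\<close> used below needs
    \<open>D > 0\<close>. If \<open>D = 0\<close>, then \<open>A = m\<^sup>2\<close>, and the bound
    \<open>m\<close> gives \<open>A powr (q / 2) \<le> N\<close> after cancelling.\<close>
  proof (cases "D = 0")
    case True
    show ?thesis
    proof (cases "A = 0")
      case False
      then have "A powr (1 - q / 2) * A powr (q / 2) = A"
        using \<open>A \<ge> 0\<close> by (simp flip: powr_add)
      then have "A powr (1 - q / 2) * A powr (q / 2) \<le> A powr (1 - q / 2) * N"
        using m D True by simp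
      then have "A powr (q / 2) \<le> N"
        using False by (simp add: mult_le_cancel_left_pos)
      then show ?thesis using True by simp
    qed (use \<open>N \<ge> 0\<close> True in simp)
  next
    case False
    then have "D > 0" using \<open>D \<ge> 0\<close> by simp
    moreover have "A \<ge> D" using D by simp
    ultimately have pos: "D > 0" "A > 0" by linarith+
    have "A powr (q / 2 - 1) * m\<^sup>2 \<le> A powr (q / 2 - 1) * (A powr (1 - q / 2) * N)"
      using m by (intro mult_left_mono) auto
    also have "\<dots> = N"
      using pos by (simp flip: powr_add mult.assoc)
    finally have "A powr (q / 2 - 1) * m\<^sup>2 \<le> N" .
    moreover have "A powr (q / 2 - 1) * A = A powr (q / 2)"
      using pos by (simp add: powr_diff)
    ultimately have "A powr (q / 2) - N \<le> A powr (q / 2 - 1) * D"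
      by (simp add: D right_diff_distrib)
    \<comment> \<open>As \<open>q / 2 - 1 < 0\<close>, the power is decreasing, and
      \<open>D \<le> A\<close>.\<close>
    also have "\<dots> \<le> D powr (q / 2 - 1) * D"
      using pos q D by (intro mult_right_mono powr_mono2') auto
    also have "\<dots> = D powr (q / 2)"
      using pos by (simp add: powr_diff)
    finally show ?thesis .
  qed
  then show ?thesis by (simp add: A_def N_def D_def)
qed

lemma power_integral_eq_integral:
  assumes "integrable (lebesgue_on \<Omega>) (\<lambda>x. \<bar>f x\<bar> powr s)"
  shows "power_integral \<Omega> s f = ennreal (\<integral>x. \<bar>f x\<bar> powr s \<partial>lebesgue_on \<Omega>)"
  unfolding power_integral_def using assms by (intro nn_integral_eq_integral) auto

lemma integrable_abs_powr_of_power_integral: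
  assumes "f \<in> borel_measurable (lebesgue_on \<Omega>)" "power_integral \<Omega> s f \<noteq> \<infinity>"
  shows "integrable (lebesgue_on \<Omega>) (\<lambda>x. \<bar>f x\<bar> powr s)"
  using assms unfolding power_integral_def
  by (intro integrableI_nonneg) (auto simp: less_top)

theorem lemma2:
  fixes \<Omega> :: "'a::euclidean_space set" and C\<^sub>P p q :: real and f :: "'a \<Rightarrow> real"
  assumes "open \<Omega>" and "connected \<Omega>" and "bounded \<Omega>" and "measure lebesgue \<Omega> = 1"
    and "C\<^sub>P > 0" and "poincare_wirtinger \<Omega> C\<^sub>P"
    and "(0 < q \<and> q < 2 \<and> 0 < p \<and> p * q \<ge> 1) \<or>
         (q = 2 \<and> p \<le> 1 \<and>
           (if DIM('a) \<le> 2 then 0 < p else 1 / 2 - 1 / real DIM('a) \<le> p))"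
    and "f \<in> H1 \<Omega>"
  shows "enn2ereal (power_integral \<Omega> q f)
           - enn2ereal (ennpowr (power_integral \<Omega> (1 / p) f) (p * q))
         \<le> ereal (C_B C\<^sub>P p q * L2_norm \<Omega> (weak_gradient \<Omega> f) powr q)"
proof -
  define M where "M = lebesgue_on \<Omega>"
  define G where "G = L2_norm \<Omega> (weak_gradient \<Omega> f)"
  define N where "N s = (\<integral>x. \<bar>f x\<bar> powr s \<partial>M)" for s
  have "\<Omega> \<in> sets lebesgue" using \<open>open \<Omega>\<close> by simp
  \<comment> \<open>Infinite measure is excluded because \<open>measure\<close> would then be
    0.\<close>
  moreover have "emeasure lebesgue \<Omega> = 1"
    using assms(4) emeasure_eq_ennreal_measure[of lebesgue \<Omega>] by (force simp: measure_def)
  ultimately interpret M: prob_space M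
    by (intro prob_spaceI) (simp add: M_def emeasure_restrict_space)
  have f [measurable]: "f \<in> borel_measurable M" and f2: "integrable M (\<lambda>x. (f x)\<^sup>2)"
    using assms(8) by (auto simp: H1_def L2_def M_def)
  have f2': "integrable M (\<lambda>x. \<bar>f x\<bar> powr 2)" using f2 by simp
  have G: "0 \<le> G" by (simp add: G_def L2_norm_def)
  have N: "0 \<le> N s" for s by (simp add: N_def)
  \<comment> \<open>The root of the variance is the \<open>L\<^sup>2\<close> distance from
    \<open>f\<close> to its mean, so this is Poincare-Wirtinger.\<close>
  have "sqrt (M.variance f) \<le> C\<^sub>P * G"
    using assms(6,8) by (simp add: poincare_wirtinger_def L2_norm_def G_def M_def)
  then have "(sqrt (M.variance f))\<^sup>2 \<le> (C\<^sub>P * G)\<^sup>2"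
    by (rule power_mono) simp
  then have var: "M.variance f \<le> (C\<^sub>P * G)\<^sup>2" by simp
  have "0 < p"
  proof (cases "q = 2 \<and> DIM('a) > 2")
    case True
    \<comment> \<open>In dimension above two the lower bound on \<open>p\<close> is itself strictly
      positive.\<close>
    then have "1 / real DIM('a) < 1 / 2" by (intro divide_strict_left_mono) auto
    moreover have "1 / 2 - 1 / real DIM('a) \<le> p" using True assms(7) by auto
    ultimately show ?thesis by linarith
  qed (use assms(7) in \<open>auto split: if_splits\<close>)
  have q: "0 < q" "q \<le> 2" using assms(7) by auto
  have fin: "enn2ereal (power_integral \<Omega> q f)
      - enn2ereal (ennpowr (power_integral \<Omega> (1 / p) f) (p * q))
      = ereal (N q - N (1 / p) powr (p * q))"
    if "integrable M (\<lambda>x. \<bar>f x\<bar> powr (1 / p))"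
    using that M.Jensen_abs_powr(1)[OF f2' q] N
    by (simp add: power_integral_eq_integral ennpowr_def M_def N_def enn2ereal_ennreal)
  from assms(7) show ?thesis
  proof
    assume asm: "0 < q \<and> q < 2 \<and> 0 < p \<and> p * q \<ge> 1"
    \<comment> \<open>The condition \<open>p * q \<ge> 1\<close> places \<open>1 / p\<close> below
      \<open>q < 2\<close>, so all integrals involved are finite and interpolation applies with
      \<open>r = 1 / p\<close>, \<open>t = 2\<close>.\<close>
    then have r: "0 < 1 / p" "1 / p \<le> q" by (auto simp: field_simps)
    have int: "integrable M (\<lambda>x. \<bar>f x\<bar> powr (1 / p))"
      using M.Jensen_abs_powr(1)[OF f2'] r asm by simp
    have "N q - N (1 / p) powr (p * q)
        \<le> 2 * (q - 1 / p) / (1 / p * (2 - q)) * (N 2 powr (q / 2) - N q)"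
      using integral_abs_powr_interpolation[OF int f2' r] asm unfolding N_def
      by (simp add: mult.commute)
    also have "2 * (q - 1 / p) / (1 / p * (2 - q)) = 2 * (p * q - 1) / (2 - q)"
      using asm by (simp add: field_simps)
    also have "\<dots> * (N 2 powr (q / 2) - N q) \<le> \<dots> * (C\<^sub>P * G) powr q"
    proof (rule mult_left_mono)
      have "N 2 powr (q / 2) - N q \<le> M.variance f powr (q / 2)"
        using M.integral_abs_powr_deficit_le_variance[OF f f2] asm by (simp add: N_def)
      also have "\<dots> \<le> ((C\<^sub>P * G)\<^sup>2) powr (q / 2)"
        using var q by (intro powr_mono2) auto
      also have "\<dots> = ((C\<^sub>P * G) powr 2) powr (q / 2)"
        using G assms(5) by simp
      also have "\<dots> = (C\<^sub>P * G) powr q"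
        unfolding powr_powr by simp
      finally show "N 2 powr (q / 2) - N q \<le> (C\<^sub>P * G) powr q" .
    qed (use asm in auto)
    also have "2 * (p * q - 1) / (2 - q) * (C\<^sub>P * G) powr q = C_B C\<^sub>P p q * G powr q"
      using asm assms(5) G by (simp add: C_B_def powr_mult)
    finally show ?thesis using fin[OF int] by (simp add: G_def)
  next
    assume "q = 2 \<and> p \<le> 1 \<and>
      (if DIM('a) \<le> 2 then 0 < p else 1 / 2 - 1 / real DIM('a) \<le> p)"
    then have q2: "q = 2" and p: "p \<le> 1" by auto
    show ?thesis
    proof (cases "power_integral \<Omega> (1 / p) f = \<infinity>")
      case True
      have "power_integral \<Omega> q f = ennreal (N q)"
        using M.Jensen_abs_powr(1)[OF f2' q] by (simp add: power_integral_eq_integral M_def N_def)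
      \<comment> \<open>A finite number minus infinity is minus infinity, so the bound is
        trivial.\<close>
      then show ?thesis using True N by (simp add: ennpowr_def enn2ereal_ennreal)
    next
      case False
      then have int: "integrable M (\<lambda>x. \<bar>f x\<bar> powr (1 / p))"
        using f unfolding M_def by (intro integrable_abs_powr_of_power_integral)
      have "\<bar>M.expectation f\<bar> \<le> (\<integral>x. \<bar>f x\<bar> \<partial>M)"
        by (rule integral_abs_bound)
      also have "\<dots> \<le> N (1 / p) powr p"
        \<comment> \<open>Jensen between the exponents 1 and \<open>1 / p\<close>, which is at least
          1 because \<open>p \<le> 1\<close>.\<close>
        using M.Jensen_abs_powr(2)[OF int, of 1] p \<open>0 < p\<close> by (simp add: N_def)
      finally have "\<bar>M.expectation f\<bar>\<^sup>2 \<le> (N (1 / p) powr p)\<^sup>2"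
        by (rule power_mono) simp
      also have "\<dots> = N (1 / p) powr (p * 2)"
        by (simp add: powr_powr flip: powr_numeral)
      finally have "N 2 - N (1 / p) powr (p * 2) \<le> N 2 - (M.expectation f)\<^sup>2"
        by simp
      also have "\<dots> = M.variance f"
        using M.variance_eq[of f] M.square_integrable_imp_integrable[OF f f2] f2
        by (simp add: N_def)
      also have "\<dots> \<le> C_B C\<^sub>P p 2 * G powr 2"
        using var G by (simp add: C_B_def power_mult_distrib)
      finally show ?thesis using fin[OF int] by (simp add: G_def q2)
    qed
  qed
qed

end
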